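(* Let $(X,\rho)$ be a complete locally compact metric space, and let $\gamma$ be a weakly-geodesic ray in $X$. Then $\lim_{t\to\infty}f(\gamma(t))$ exists for every $f\in\mathcal{G}(X,\rho)$, and defines an element of $\partial_\rho X$ (i.e. there is a point $u\in\partial_\rho X$ with $f(u)=\lim_{t\to\infty} f(\gamma(t))$ for all $f\in\mathcal{G}(X,\rho)=C(\bar X^\rho)$). Conversely, if $\rho$ is proper and if the topology of $(X,\rho)$ has a countable base, then every point of $\partial_\rho X$ is determined in this way by a weakly-geodesic ray.
   Context: For $y,z\in X$ let $\varphi_{y,z}(x)=\rho(x,y)-\rho(x,z)$, a bounded continuous function on $X$, and let $H_\rho$ be the linear span of all $\varphi_{y,z}$ in $C_b(X)$ (bounded continuous functions, supremum norm). $\mathcal{G}(X,\rho)$ is the norm-closed subalgebra of $C_b(X)$ generated by $C_\infty(X)$ (continuous functions vanishing at infinity), the constant functions, and $H_\rho$. Its maximal ideal space $\bar X^\rho$ is the metric compactification of $X$, so $\mathcal{G}(X,\rho)=C(\bar X^\rho)$; $X$ is an open dense subset of $\bar X^\rho$. For $X$ complete and locally compact, the metric boundary is $\partial_\rho X=\bar X^\rho\setminus X$. Let $T$ be an unbounded subset of $\mathbb{R}^+=[0,\infty)$ containing $0$. A function $\gamma:T\to X$ is a weakly-geodesic ray if for every $y\in X$ and every $\varepsilon>0$ there is an integer $N$ such that for all $s,t\in T$ with $s,t\ge N$, $$|\rho(\gamma(t),\gamma(0))-t|<\varepsilon\quad\text{and}\quad|\rho(\gamma(t),y)-\rho(\gamma(s),y)-(t-s)|<\varepsilon.$$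 Limits as $t\to\infty$ are along $t\in T$. The metric $\rho$ is proper if every closed ball of finite radius is compact. *)

theory Defs
  imports "HOL-Analysis.Analysis"
begin

section \<open>The algebra of bounded continuous functions\<close>

text \<open>
  The algebra \<open>C\<^sub>b(X)\<close> is the library type \<open>'a \<Rightarrow>\<^sub>C complex\<close>, which carries the supremum norm;
  only its complex scalar multiplication and its product are missing from the library.
\<close>

unbundle bcontfun.lifting

lift_definition times_bcontfun ::
    "('a::topological_space \<Rightarrow>\<^sub>C complex) \<Rightarrow> ('a \<Rightarrow>\<^sub>C complex) \<Rightarrow> ('a \<Rightarrow>\<^sub>C complex)"
  is "\<lambda>f g x. f x * g x"
proof -
  fix f g :: "'a \<Rightarrow> complex"
  assume f: "f \<in> bcontfun" and g: "g \<in> bcontfun"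
  then obtain a b where ab: "\<And>x. norm (f x) \<le> a" "\<And>x. norm (g x) \<le> b"
    by (auto simp: bcontfun_def bounded_iff)
  show "(\<lambda>x. f x * g x) \<in> bcontfun"
  proof (rule bcontfun_normI)
    show "continuous_on UNIV (\<lambda>x. f x * g x)"
      using f g by (auto simp: bcontfun_def intro: continuous_intros)
    show "norm (f x * g x) \<le> a * b" for x
      using ab[of x] by (auto simp: norm_mult intro!: mult_mono order_trans[OF norm_ge_zero])
  qed
qed

definition scaleC_bcontfun ::
    "complex \<Rightarrow> ('a::topological_space \<Rightarrow>\<^sub>C complex) \<Rightarrow> ('a \<Rightarrow>\<^sub>C complex)"
  where "scaleC_bcontfun c f = times_bcontfun (const_bcontfun c) f"

lemma apply_times_bcontfun [simp]: "times_bcontfun f g x = f x * g x"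
  by transfer simp

lemma apply_scaleC_bcontfun [simp]: "scaleC_bcontfun c f x = c * f x"
  by (simp add: scaleC_bcontfun_def const_bcontfun.rep_eq)

global_interpretation bcontfun: vector_space
    "scaleC_bcontfun :: complex \<Rightarrow> ('a::topological_space \<Rightarrow>\<^sub>C complex) \<Rightarrow> ('a \<Rightarrow>\<^sub>C complex)"
  by unfold_locales (auto intro!: bcontfun_eqI simp: algebra_simps)

definition norm_closed_subalgebra :: "('a::topological_space \<Rightarrow>\<^sub>C complex) set \<Rightarrow> bool"
  where "norm_closed_subalgebra A \<longleftrightarrow>
    bcontfun.subspace A \<and> (\<forall>f\<in>A. \<forall>g\<in>A. times_bcontfun f g \<in> A) \<and> closed A"

definition generated_norm_closed_subalgebra ::
    "('a::topological_space \<Rightarrow>\<^sub>C complex) set \<Rightarrow> ('a \<Rightarrow>\<^sub>C complex) set"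
  where "generated_norm_closed_subalgebra S = \<Inter>{A. norm_closed_subalgebra A \<and> S \<subseteq> A}"


section \<open>The algebra \<open>\<G>(X,\<rho>)\<close>\<close>

text \<open>The metric space \<open>(X,\<rho>)\<close> is the type \<open>'a::metric_space\<close> with \<^term>\<open>dist\<close>.\<close>

lift_definition dist_difference :: "'a::metric_space \<Rightarrow> 'a \<Rightarrow> ('a \<Rightarrow>\<^sub>C complex)"
  is "\<lambda>y z x. of_real (dist x y - dist x z)"
proof (rule bcontfun_normI)
  fix y z :: 'a
  show "continuous_on UNIV (\<lambda>x. of_real (dist x y - dist x z) :: complex)"
    by (intro continuous_intros)
  show "norm (of_real (dist x y - dist x z) :: complex) \<le> dist y z" for x
    unfolding norm_of_real
    using dist_triangle[of x y z] dist_triangle2[of x z y] by (simp add: dist_commute abs_le_iff)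
qed

definition dist_difference_span :: "('a::metric_space \<Rightarrow>\<^sub>C complex) set"
  where "dist_difference_span = bcontfun.span {dist_difference y z | y z. True}"

definition vanishing_at_infinity :: "('a::topological_space \<Rightarrow>\<^sub>C complex) set"
  where "vanishing_at_infinity =
    {f. \<forall>\<epsilon>>0. \<exists>K. compact K \<and> (\<forall>x. x \<notin> K \<longrightarrow> norm (apply_bcontfun f x) < \<epsilon>)}"

definition metric_algebra :: "('a::metric_space \<Rightarrow>\<^sub>C complex) set"
  where "metric_algebra =
    generated_norm_closed_subalgebra
      (vanishing_at_infinity \<union> range const_bcontfun \<union> dist_difference_span)"


section \<open>The metric compactification and the metric boundary\<close>

text \<open>
  A character is made extensional (\<^term>\<open>undefined\<close> outside \<open>A\<close>), so that two characters that
  agree on \<open>A\<close> are equal.  The topology of the maximal ideal space is the topology of pointwise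
  convergence on \<open>A\<close>.
\<close>

definition character_on ::
    "('a::topological_space \<Rightarrow>\<^sub>C complex) set \<Rightarrow> (('a \<Rightarrow>\<^sub>C complex) \<Rightarrow> complex) \<Rightarrow> bool"
  where "character_on A u \<longleftrightarrow>
    u \<in> extensional A \<and>
    (\<forall>f\<in>A. \<forall>g\<in>A. u (f + g) = u f + u g) \<and>
    (\<forall>c. \<forall>f\<in>A. u (scaleC_bcontfun c f) = c * u f) \<and>
    (\<forall>f\<in>A. \<forall>g\<in>A. u (times_bcontfun f g) = u f * u g) \<and>
    (\<exists>f\<in>A. u f \<noteq> 0)"

definition maximal_ideal_space ::
    "('a::topological_space \<Rightarrow>\<^sub>C complex) set \<Rightarrow> (('a \<Rightarrow>\<^sub>C complex) \<Rightarrow> complex) topology"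
  where "maximal_ideal_space A =
    subtopology (product_topology (\<lambda>_. euclidean) A) {u. character_on A u}"

definition metric_compactification ::
    "(('a::metric_space \<Rightarrow>\<^sub>C complex) \<Rightarrow> complex) topology"
  where "metric_compactification = maximal_ideal_space metric_algebra"

text \<open>
  A function \<open>f\<close> in the algebra, viewed as a function on the compactification, is the map
  \<open>u \<mapsto> u f\<close>, and a point \<open>x\<close> of \<open>X\<close> is identified with the evaluation at \<open>x\<close>.
\<close>

definition evaluation_at :: "'a::metric_space \<Rightarrow> ('a \<Rightarrow>\<^sub>C complex) \<Rightarrow> complex"
  where "evaluation_at x = (\<lambda>f\<in>metric_algebra. apply_bcontfun f x)"

definition metric_boundary :: "(('a::metric_space \<Rightarrow>\<^sub>C complex) \<Rightarrow> complex) set"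
  where "metric_boundary = topspace metric_compactification - range evaluation_at"


section \<open>Weakly-geodesic rays and proper metrics\<close>

text \<open>The values of \<open>\<gamma>\<close> outside \<open>T\<close> are irrelevant.\<close>

definition weakly_geodesic_ray :: "real set \<Rightarrow> (real \<Rightarrow> 'a::metric_space) \<Rightarrow> bool"
  where "weakly_geodesic_ray T \<gamma> \<longleftrightarrow>
    T \<subseteq> {0..} \<and> 0 \<in> T \<and> \<not> bounded T \<and>
    (\<forall>y. \<forall>\<epsilon>>0. \<exists>N::int. \<forall>s\<in>T. \<forall>t\<in>T. s \<ge> of_int N \<and> t \<ge> of_int N \<longrightarrow>
      \<bar>dist (\<gamma> t) (\<gamma> 0) - t\<bar> < \<epsilon> \<and>
      \<bar>dist (\<gamma> t) y - dist (\<gamma> s) y - (t - s)\<bar> < \<epsilon>)"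

definition at_top_within :: "real set \<Rightarrow> real filter"
  where "at_top_within T = inf at_top (principal T)"

definition proper_metric :: "'a::metric_space itself \<Rightarrow> bool"
  where "proper_metric _ \<longleftrightarrow> (\<forall>(x::'a) r. compact (cball x r))"

end

theory Submission
  imports Defs
begin

text \<open>
  Write \<open>\<phi>\<^sub>y\<^sub>,\<^sub>z\<close> for the function \<open>x \<mapsto> \<rho>(x,y) - \<rho>(x,z)\<close>.

  Along a weakly-geodesic ray \<open>\<gamma>\<close> each \<open>\<rho>(\<gamma>(t),y) - t\<close> satisfies the Cauchy condition, so every
  \<open>\<phi>\<^sub>y\<^sub>,\<^sub>z(\<gamma>(t))\<close>, being a difference of two such functions, converges.  The ray leaves every compact
  set, so functions vanishing at infinity tend to \<open>0\<close> along it.  The functions that converge along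
  \<open>\<gamma>\<close> form a closed subalgebra, hence include all of \<open>\<G>(X,\<rho>)\<close>, and the limits form a character.
  It kills every function vanishing at infinity; by local compactness some such function is
  nonzero at any given point of \<open>X\<close>, so this character is not a point of \<open>X\<close>.

  Conversely, let \<open>u\<close> be a boundary point.  Two facts about characters are needed.
  First, the points of \<open>X\<close> are dense in the compactification (\<open>points_dense_in_characters\<close>): if
  \<open>u\<close> vanished on finitely many \<open>f\<^sub>i\<close> with \<open>\<Sum>\<bar>f\<^sub>i\<bar>\<^sup>2\<close> bounded below, it would vanish on an
  invertible element.  Second, \<open>u\<close> kills the functions vanishing at infinity
  (\<open>metric_boundary_vanishing\<close>), for otherwise density and compactness would produce a point of
  \<open>X\<close> whose evaluation is \<open>u\<close>.  Hence \<open>u\<close> is determined by its values on the \<open>\<phi>\<^sub>y\<^sub>,\<^sub>z\<close> with \<open>z\<close>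
  fixed (\<open>metric_boundary_eqI\<close>).

  Separability and properness then give a sequence \<open>x\<^sub>n\<close> with \<open>\<rho>(x\<^sub>n,z) \<rightarrow> \<infinity>\<close> and
  \<open>\<phi>\<^sub>y\<^sub>,\<^sub>z(x\<^sub>n) \<rightarrow> u(\<phi>\<^sub>y\<^sub>,\<^sub>z)\<close> for every \<open>y\<close>.  The key observation is that such a sequence already
  is a weakly-geodesic ray when \<open>x\<^sub>n\<close> is visited at time \<open>\<rho>(x\<^sub>n,z)\<close>: with that parametrization
  \<open>\<rho>(\<gamma>(t),y) - \<rho>(\<gamma>(s),y) - (t - s) = \<phi>\<^sub>y\<^sub>,\<^sub>z(\<gamma>(t)) - \<phi>\<^sub>y\<^sub>,\<^sub>z(\<gamma>(s))\<close>, which is small because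
  \<open>\<phi>\<^sub>y\<^sub>,\<^sub>z\<close> converges along the ray.  The end of this ray agrees with \<open>u\<close> on every \<open>\<phi>\<^sub>y\<^sub>,\<^sub>z\<close>,
  hence everywhere.
\<close>

section \<open>Closed subalgebras of \<open>C\<^sub>b(X)\<close>\<close>

lemma norm_closed_subalgebraD:
  assumes "norm_closed_subalgebra A"
  shows norm_closed_subalgebra_zero: "0 \<in> A"
    and norm_closed_subalgebra_add: "\<And>f g. f \<in> A \<Longrightarrow> g \<in> A \<Longrightarrow> f + g \<in> A"
    and norm_closed_subalgebra_scale: "\<And>c f. f \<in> A \<Longrightarrow> scaleC_bcontfun c f \<in> A"
    and norm_closed_subalgebra_diff: "\<And>f g. f \<in> A \<Longrightarrow> g \<in> A \<Longrightarrow> f - g \<in> A"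
    and norm_closed_subalgebra_times: "\<And>f g. f \<in> A \<Longrightarrow> g \<in> A \<Longrightarrow> times_bcontfun f g \<in> A"
    and norm_closed_subalgebra_closed: "closed A"
  using assms unfolding norm_closed_subalgebra_def
  by (auto intro: bcontfun.subspace_0 bcontfun.subspace_add bcontfun.subspace_scale
      bcontfun.subspace_diff)

lemma norm_closed_subalgebra_approx:
  assumes "norm_closed_subalgebra A" and "\<And>e. e > 0 \<Longrightarrow> \<exists>g\<in>A. dist g f < e"
  shows "f \<in> A"
  using assms closure_approachable[of f A] closure_closed[OF norm_closed_subalgebra_closed[OF assms(1)]]
  by auto

lemma norm_closed_subalgebraI:
  assumes "0 \<in> A"
    and "\<And>f g. f \<in> A \<Longrightarrow> g \<in> A \<Longrightarrow> f + g \<in> A"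
    and "\<And>c f. f \<in> A \<Longrightarrow> scaleC_bcontfun c f \<in> A"
    and "\<And>f g. f \<in> A \<Longrightarrow> g \<in> A \<Longrightarrow> times_bcontfun f g \<in> A"
    and approx: "\<And>f. (\<And>e. e > 0 \<Longrightarrow> \<exists>g\<in>A. dist g f < e) \<Longrightarrow> f \<in> A"
  shows "norm_closed_subalgebra A"
proof -
  have "closure A \<subseteq> A"
    using approx by (auto simp: closure_approachable)
  then have "closed A"
    by (simp add: closure_subset_eq)
  then show ?thesis
    using assms(1-4) unfolding norm_closed_subalgebra_def bcontfun.subspace_def by blast
qed

lemma norm_closed_subalgebra_metric_algebra: "norm_closed_subalgebra metric_algebra"
proof (rule norm_closed_subalgebraI)
  fix f :: "'a \<Rightarrow>\<^sub>C complex"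
  assume *: "\<And>e. e > 0 \<Longrightarrow> \<exists>g\<in>metric_algebra. dist g f < e"
  show "f \<in> metric_algebra"
    unfolding metric_algebra_def generated_norm_closed_subalgebra_def
  proof (rule InterI)
    fix A :: "('a \<Rightarrow>\<^sub>C complex) set" assume A: "A \<in> {A. norm_closed_subalgebra A \<and>
        vanishing_at_infinity \<union> range const_bcontfun \<union> dist_difference_span \<subseteq> A}"
    then have "metric_algebra \<subseteq> A"
      unfolding metric_algebra_def generated_norm_closed_subalgebra_def by blast
    with * have "\<exists>g\<in>A. dist g f < e" if "e > 0" for e using that by blast
    moreover have "norm_closed_subalgebra A" using A by blast
    ultimately show "f \<in> A" using norm_closed_subalgebra_approx by blast
  qed
qed (auto simp: metric_algebra_def generated_norm_closed_subalgebra_def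
      intro: norm_closed_subalgebraD)

lemma dist_difference_in_span: "dist_difference y z \<in> dist_difference_span"
  unfolding dist_difference_span_def by (rule bcontfun.span_base) blast

lemma vanishing_in_metric_algebra: "f \<in> vanishing_at_infinity \<Longrightarrow> f \<in> metric_algebra"
  and const_in_metric_algebra: "const_bcontfun c \<in> metric_algebra"
  and dist_difference_in_metric_algebra: "dist_difference y z \<in> metric_algebra"
  unfolding metric_algebra_def generated_norm_closed_subalgebra_def
  using dist_difference_in_span[of y z] by blast+

text \<open>
  The induction principle of the generated algebra, by which a property of all of \<open>\<G>(X,\<rho>)\<close> is
  reduced to the generators.
\<close>

lemma metric_algebra_subset:
  assumes B: "norm_closed_subalgebra B"
    and "vanishing_at_infinity \<subseteq> B" "\<And>c. const_bcontfun c \<in> B"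
    and dd: "\<And>y z. dist_difference y z \<in> B"
  shows "metric_algebra \<subseteq> B"
proof -
  have "dist_difference_span \<subseteq> B"
    unfolding dist_difference_span_def
    using B dd by (intro bcontfun.span_minimal) (auto simp: norm_closed_subalgebra_def)
  then show ?thesis
    using assms unfolding metric_algebra_def generated_norm_closed_subalgebra_def by blast
qed

lift_definition cnj_bcontfun :: "('a::topological_space \<Rightarrow>\<^sub>C complex) \<Rightarrow> ('a \<Rightarrow>\<^sub>C complex)"
  is "\<lambda>f x. cnj (f x)"
  by (auto simp: bcontfun_def bounded_iff intro!: continuous_intros)

lemma apply_cnj_bcontfun [simp]: "cnj_bcontfun f x = cnj (f x)"
  by transfer simp

lemma apply_dist_difference [simp]:
  "dist_difference y z x = of_real (dist x y - dist x z)"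
  by transfer simp

lemma apply_const_bcontfun [simp]: "const_bcontfun c x = c"
  by transfer simp

text \<open>
  Generation uses only sums, products and scalar multiples, but the density argument below needs
  \<open>\<bar>f\<bar>\<^sup>2\<close> in the algebra.  The algebra is self-adjoint because its generating set is.
\<close>

lemma cnj_in_metric_algebra:
  assumes "f \<in> metric_algebra"
  shows "cnj_bcontfun f \<in> metric_algebra"
proof -
  note A = norm_closed_subalgebra_metric_algebra
  have "metric_algebra \<subseteq> {f. cnj_bcontfun f \<in> (metric_algebra :: ('a \<Rightarrow>\<^sub>C complex) set)}"
  proof (rule metric_algebra_subset)
    show "norm_closed_subalgebra {f. cnj_bcontfun f \<in> (metric_algebra :: ('a \<Rightarrow>\<^sub>C complex) set)}"
    proof (rule norm_closed_subalgebraI, simp_all)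
      have "cnj_bcontfun 0 = (0 :: 'a \<Rightarrow>\<^sub>C complex)" by (rule bcontfun_eqI) simp
      then show "cnj_bcontfun 0 \<in> (metric_algebra :: ('a \<Rightarrow>\<^sub>C complex) set)"
        using norm_closed_subalgebra_zero[OF A] by simp
    next
      fix f g :: "'a \<Rightarrow>\<^sub>C complex"
      assume fg: "cnj_bcontfun f \<in> metric_algebra" "cnj_bcontfun g \<in> metric_algebra"
      have "cnj_bcontfun (f + g) = cnj_bcontfun f + cnj_bcontfun g"
        by (rule bcontfun_eqI) simp
      then show "cnj_bcontfun (f + g) \<in> metric_algebra"
        using norm_closed_subalgebra_add[OF A fg] by simp
      have "cnj_bcontfun (times_bcontfun f g) = times_bcontfun (cnj_bcontfun f) (cnj_bcontfun g)"
        by (rule bcontfun_eqI) simp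
      then show "cnj_bcontfun (times_bcontfun f g) \<in> metric_algebra"
        using norm_closed_subalgebra_times[OF A fg] by simp
    next
      fix f :: "'a \<Rightarrow>\<^sub>C complex" and c
      assume f: "cnj_bcontfun f \<in> metric_algebra"
      have "cnj_bcontfun (scaleC_bcontfun c f) = scaleC_bcontfun (cnj c) (cnj_bcontfun f)"
        by (rule bcontfun_eqI) simp
      then show "cnj_bcontfun (scaleC_bcontfun c f) \<in> metric_algebra"
        using norm_closed_subalgebra_scale[OF A f] by simp
    next
      fix f :: "'a \<Rightarrow>\<^sub>C complex"
      assume *: "\<And>e. e > 0 \<Longrightarrow> \<exists>g. cnj_bcontfun g \<in> metric_algebra \<and> dist g f < e"
      have isometry: "dist (cnj_bcontfun g) (cnj_bcontfun f) \<le> dist g f" for g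
        by (rule dist_bound)
          (metis apply_cnj_bcontfun complex_cnj_diff complex_mod_cnj dist_bounded dist_norm)
      show "cnj_bcontfun f \<in> metric_algebra"
        by (rule norm_closed_subalgebra_approx[OF A]) (use * isometry in \<open>meson le_less_trans\<close>)
    qed
    have "cnj_bcontfun (const_bcontfun c) = (const_bcontfun (cnj c) :: 'a \<Rightarrow>\<^sub>C complex)" for c
      by (rule bcontfun_eqI) simp
    then show "const_bcontfun c \<in> {f. cnj_bcontfun f \<in> (metric_algebra :: ('a \<Rightarrow>\<^sub>C complex) set)}" for c
      by (simp add: const_in_metric_algebra)
    have "cnj_bcontfun (dist_difference y z) = dist_difference y z" for y z :: 'a
      by (rule bcontfun_eqI) simp
    then show "dist_difference y z \<in> {f. cnj_bcontfun f \<in> metric_algebra}" for y z :: 'a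
      by (simp add: dist_difference_in_metric_algebra)
  qed (auto simp: vanishing_at_infinity_def intro!: vanishing_in_metric_algebra)
  with assms show ?thesis by blast
qed

text \<open>
  In the proof below these functions separate points from infinity, and, when closed balls are
  compact, detect that a point is far from the center.
\<close>

lift_definition tent :: "'a::metric_space \<Rightarrow> real \<Rightarrow> ('a \<Rightarrow>\<^sub>C complex)"
  is "\<lambda>x r z. of_real (max 0 (r - dist z x))"
proof (rule bcontfun_normI)
  fix x :: 'a and r :: real
  show "continuous_on UNIV (\<lambda>z. of_real (max 0 (r - dist z x)) :: complex)"
    by (intro continuous_intros)
  show "norm (of_real (max 0 (r - dist z x)) :: complex) \<le> \<bar>r\<bar>" for z
    unfolding norm_of_real using zero_le_dist[of z x] by linarith
qed

lemma apply_tent [simp]: "tent x r z = of_real (max 0 (r - dist z x))"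
  by transfer simp

lemma tent_vanishing_at_infinity:
  assumes "compact (cball x r)"
  shows "tent x r \<in> vanishing_at_infinity"
  unfolding vanishing_at_infinity_def
  using assms by (auto simp: dist_commute intro!: exI[of _ "cball x r"])

section \<open>Characters\<close>

lemma character_onD:
  assumes "character_on A u"
  shows character_on_add: "\<And>f g. f \<in> A \<Longrightarrow> g \<in> A \<Longrightarrow> u (f + g) = u f + u g"
    and character_on_scale: "\<And>c f. f \<in> A \<Longrightarrow> u (scaleC_bcontfun c f) = c * u f"
    and character_on_times: "\<And>f g. f \<in> A \<Longrightarrow> g \<in> A \<Longrightarrow> u (times_bcontfun f g) = u f * u g"
  using assms by (auto simp: character_on_def)

lemma character_on_zero:
  assumes "norm_closed_subalgebra A" "character_on A u"
  shows "u 0 = 0"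
  using character_on_scale[OF assms(2), of 0 0] norm_closed_subalgebra_zero[OF assms(1)] by simp

lemma character_on_diff:
  assumes A: "norm_closed_subalgebra A" and u: "character_on A u" and fg: "f \<in> A" "g \<in> A"
  shows "u (f - g) = u f - u g"
  using character_on_add[OF u norm_closed_subalgebra_diff[OF A fg] fg(2)] by simp

lemma character_on_const:
  assumes u: "character_on A u" and c: "\<And>c. const_bcontfun c \<in> A"
  shows "u (const_bcontfun c) = c"
proof -
  obtain f where f: "f \<in> A" "u f \<noteq> 0" using u by (auto simp: character_on_def)
  have "c * u f = u (const_bcontfun c) * u f"
    using character_on_scale[OF u f(1), of c] character_on_times[OF u c f(1), of c]
    unfolding scaleC_bcontfun_def by metis
  with f show ?thesis by simp
qed

text \<open>
  The Neumann series \<open>g = h + h\<^sup>2 + h\<^sup>3 + \<dots>\<close> lies in \<open>A\<close> and satisfies \<open>g = h + h g\<close>; a character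
  with value \<open>1\<close> at \<open>h\<close> would give \<open>u(g) = 1 + u(g)\<close>.  The series is obtained here as the fixed
  point of the contraction \<open>g \<mapsto> h + h g\<close>.
\<close>

lemma character_on_neq_1:
  fixes h :: "'a::metric_space \<Rightarrow>\<^sub>C complex"
  assumes A: "norm_closed_subalgebra A" and u: "character_on A u"
    and h: "h \<in> A" "norm h < 1"
  shows "u h \<noteq> 1"
proof
  assume 1: "u h = 1"
  have "\<exists>!g\<in>A. h + times_bcontfun h g = g"
  proof (rule Banach_fix)
    show "complete A"
      using norm_closed_subalgebra_closed[OF A] by (simp add: complete_eq_closed)
    show "(\<lambda>g. h + times_bcontfun h g) ` A \<subseteq> A"
      using h(1) A by (auto intro: norm_closed_subalgebraD)
    show "dist (h + times_bcontfun h f) (h + times_bcontfun h g) \<le> norm h * dist f g" for f g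
    proof (rule dist_bound)
      fix x
      have "dist ((h + times_bcontfun h f) x) ((h + times_bcontfun h g) x)
          = norm (h x) * dist (f x) (g x)"
        by (simp add: dist_norm norm_mult flip: right_diff_distrib)
      also have "\<dots> \<le> norm h * dist f g"
        by (intro mult_mono norm_bounded dist_bounded) auto
      finally show "dist ((h + times_bcontfun h f) x) ((h + times_bcontfun h g) x)
          \<le> norm h * dist f g" .
    qed
  qed (use h in auto)
  then obtain g where g: "g \<in> A" "h + times_bcontfun h g = g" by blast
  have "u g = u h + u h * u g"
    using g h A u by (metis character_on_add character_on_times norm_closed_subalgebra_times)
  with 1 show False by simp
qed

lemma character_on_contractive:
  fixes f :: "'a::metric_space \<Rightarrow>\<^sub>C complex"
  assumes A: "norm_closed_subalgebra A" and u: "character_on A u" and f: "f \<in> A"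
  shows "norm (u f) \<le> norm f"
proof (rule ccontr)
  assume *: "\<not> ?thesis"
  define h where "h = scaleC_bcontfun (1 / u f) f"
  have "u f \<noteq> 0" using * by (auto simp: not_le)
  have "norm h \<le> norm f / norm (u f)"
    by (rule norm_bound)
      (auto simp: h_def norm_mult norm_divide intro!: divide_right_mono norm_bounded)
  also have "\<dots> < 1" using * by (auto simp: not_le divide_simps)
  finally have "norm h < 1" .
  moreover have "h \<in> A" unfolding h_def by (rule norm_closed_subalgebra_scale[OF A f])
  moreover have "u h = 1"
    using \<open>u f \<noteq> 0\<close> by (simp add: h_def character_on_scale[OF u f])
  ultimately show False using character_on_neq_1[OF A u] by blast
qed

text \<open>
  Otherwise \<open>G = \<Sum>\<bar>f\<bar>\<^sup>2\<close> would satisfy \<open>1 \<le> G \<le> \<parallel>G\<parallel>\<close> while \<open>u(G) = 0\<close>.  Then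
  \<open>h = 1 - G/\<parallel>G\<parallel>\<close> has norm below \<open>1\<close> and \<open>u(h) = 1\<close>, which is impossible.
\<close>

lemma character_on_kernel_small:
  fixes F :: "('a::metric_space \<Rightarrow>\<^sub>C complex) set"
  assumes A: "norm_closed_subalgebra A" and const: "\<And>c. const_bcontfun c \<in> A"
    and cnj: "\<And>f. f \<in> A \<Longrightarrow> cnj_bcontfun f \<in> A"
    and u: "character_on A u" and F: "finite F" "F \<subseteq> A" "\<And>f. f \<in> F \<Longrightarrow> u f = 0"
  shows "\<exists>x. \<forall>f\<in>F. norm (f x) < 1"
proof (rule ccontr)
  assume "\<not> ?thesis"
  then have large: "\<exists>f\<in>F. 1 \<le> norm (f x)" for x by (auto simp: not_less)
  have "\<exists>G\<in>A. u G = 0 \<and> (\<forall>x. G x = of_real (\<Sum>f\<in>F. (norm (apply_bcontfun f x))\<^sup>2))"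
    using F
  proof (induction F rule: finite_induct)
    case empty
    then show ?case
      using norm_closed_subalgebra_zero[OF A] character_on_zero[OF A u] by (auto intro!: bexI[of _ 0])
  next
    case (insert f F)
    then obtain G where G: "G \<in> A" "u G = 0" "\<And>x. G x = of_real (\<Sum>f\<in>F. (norm (apply_bcontfun f x))\<^sup>2)"
      by auto
    have f: "f \<in> A" "cnj_bcontfun f \<in> A" using insert.prems cnj by auto
    define G' where "G' = times_bcontfun f (cnj_bcontfun f) + G"
    have ff: "times_bcontfun f (cnj_bcontfun f) \<in> A"
      by (rule norm_closed_subalgebra_times[OF A f])
    have "G' \<in> A" unfolding G'_def by (rule norm_closed_subalgebra_add[OF A ff G(1)])
    moreover have "u G' = 0"
      using insert.prems f G
      by (simp add: G'_def character_on_add[OF u ff G(1)] character_on_times[OF u f])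
    moreover have "G' x = of_real (\<Sum>f\<in>insert f F. (norm (apply_bcontfun f x))\<^sup>2)" for x
      using insert.hyps G(3) by (simp add: G'_def flip: complex_norm_square)
    ultimately show ?case by blast
  qed
  then obtain G where G: "G \<in> A" "u G = 0" "\<And>x. G x = of_real (\<Sum>f\<in>F. (norm (apply_bcontfun f x))\<^sup>2)"
    by blast
  have G1: "1 \<le> (\<Sum>f\<in>F. (norm (apply_bcontfun f x))\<^sup>2)" for x
  proof -
    obtain f where f: "f \<in> F" "1 \<le> norm (f x)" using large by blast
    then have "1 \<le> (norm (f x))\<^sup>2" by simp
    also have "\<dots> \<le> (\<Sum>f\<in>F. (norm (apply_bcontfun f x))\<^sup>2)"
      using F(1) f(1) by (intro member_le_sum) auto
    finally show ?thesis .
  qed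
  have GM: "(\<Sum>f\<in>F. (norm (apply_bcontfun f x))\<^sup>2) \<le> norm G" for x
    using norm_bounded[of G x] G1[of x] unfolding G(3) norm_of_real by simp
  have M: "1 \<le> norm G" using G1 GM order_trans by blast
  define h where "h = const_bcontfun 1 - scaleC_bcontfun (1 / of_real (norm G)) G"
  have hA: "h \<in> A" unfolding h_def
    by (intro norm_closed_subalgebra_diff[OF A] norm_closed_subalgebra_scale[OF A] const G)
  have "u h = 1" unfolding h_def
    using G by (subst character_on_diff[OF A u])
      (auto simp: character_on_const[OF u const] character_on_scale[OF u]
        intro: const norm_closed_subalgebra_scale[OF A])
  moreover have "norm h \<le> 1 - 1 / norm G"
  proof (rule norm_bound)
    fix x
    have "h x = of_real (1 - (\<Sum>f\<in>F. (norm (apply_bcontfun f x))\<^sup>2) / norm G)"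
      by (simp add: h_def G(3))
    then have "norm (h x) = \<bar>1 - (\<Sum>f\<in>F. (norm (apply_bcontfun f x))\<^sup>2) / norm G\<bar>"
      by (simp only: norm_of_real)
    also have "\<dots> = 1 - (\<Sum>f\<in>F. (norm (apply_bcontfun f x))\<^sup>2) / norm G"
      using GM[of x] M by (simp add: divide_simps)
    also have "\<dots> \<le> 1 - 1 / norm G"
      using G1[of x] M by (simp add: divide_right_mono)
    finally show "norm (h x) \<le> 1 - 1 / norm G" .
  qed
  moreover have "1 - 1 / norm G < 1" using M by auto
  ultimately show False using character_on_neq_1[OF A u hA] by linarith
qed

text \<open>
  Density of \<open>X\<close> in the maximal ideal space, stated on a basic neighbourhood of \<open>u\<close>; it is the
  preceding lemma applied to the functions \<open>(f - u(f))/e\<close>.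
\<close>

lemma points_dense_in_characters:
  fixes F :: "('a::metric_space \<Rightarrow>\<^sub>C complex) set"
  assumes A: "norm_closed_subalgebra A" and const: "\<And>c. const_bcontfun c \<in> A"
    and cnj: "\<And>f. f \<in> A \<Longrightarrow> cnj_bcontfun f \<in> A"
    and u: "character_on A u" and F: "finite F" "F \<subseteq> A" and e: "e > 0"
  shows "\<exists>x. \<forall>f\<in>F. norm (apply_bcontfun f x - u f) < e"
proof -
  define k where "k f = scaleC_bcontfun (of_real (1 / e)) (f - const_bcontfun (u f))" for f
  have d: "f - const_bcontfun (u f) \<in> A" if "f \<in> F" for f
    using that F by (intro norm_closed_subalgebra_diff[OF A] const) auto
  have "\<exists>x. \<forall>g\<in>k ` F. norm (g x) < 1"
  proof (rule character_on_kernel_small[OF A const cnj u])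
    show "k ` F \<subseteq> A" using d by (auto simp: k_def intro: norm_closed_subalgebra_scale[OF A])
    show "u g = 0" if "g \<in> k ` F" for g
      using that F(2)
      by (auto simp: k_def character_on_scale[OF u d] character_on_diff[OF A u _ const] subset_iff
          character_on_const[OF u const])
  qed (use F in auto)
  then obtain x where x: "\<forall>f\<in>F. norm (k f x) < 1" by auto
  have "norm (k f x) = norm (apply_bcontfun f x - u f) / e" for f
    using e by (simp add: k_def norm_mult norm_divide)
  with x e show ?thesis by (auto intro!: exI[of _ x])
qed

section \<open>Boundary points\<close>

lemma metric_boundary_iff:
  "u \<in> metric_boundary \<longleftrightarrow>
     character_on metric_algebra u \<and> (\<forall>x. u \<noteq> evaluation_at x)"
  by (auto simp: metric_boundary_def metric_compactification_def maximal_ideal_space_def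
      character_on_def PiE_def extensional_def)

text \<open>
  If \<open>u(f) \<noteq> 0\<close>, points close to \<open>u\<close> must lie in the compact set \<open>K\<close> outside which
  \<open>\<bar>f\<bar> < \<bar>u(f)\<bar>/2\<close>.  By density the closed sets \<open>{x. \<bar>g(x) - u(g)\<bar> \<le> 1}\<close> then have the finite
  intersection property in \<open>K\<close>.  At a common point \<open>x\<close> the bound holds for all multiples of \<open>g\<close> as
  well, which forces \<open>u(g) = g(x)\<close>.
\<close>

lemma metric_boundary_vanishing:
  fixes u :: "('a::metric_space \<Rightarrow>\<^sub>C complex) \<Rightarrow> complex"
  assumes "u \<in> metric_boundary" and f: "f \<in> vanishing_at_infinity"
  shows "u f = 0"
proof (rule ccontr)
  assume "u f \<noteq> 0"
  have u: "character_on metric_algebra u" and not_ev: "\<And>x. u \<noteq> evaluation_at x"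
    using assms(1) by (auto simp: metric_boundary_iff)
  note A = norm_closed_subalgebra_metric_algebra
  obtain K where K: "compact K" "\<And>x. x \<notin> K \<Longrightarrow> norm (f x) < norm (u f) / 2"
    using f \<open>u f \<noteq> 0\<close> unfolding vanishing_at_infinity_def
    by (smt (verit) half_gt_zero mem_Collect_eq zero_less_norm_iff)
  have "K \<inter> (\<Inter>g\<in>metric_algebra. {x. norm (apply_bcontfun g x - u g) \<le> 1}) \<noteq> {}"
  proof (rule compact_imp_fip_image[OF K(1)])
    show "closed {x. norm (apply_bcontfun g x - u g) \<le> 1}" for g
      by (intro closed_Collect_le continuous_intros continuous_on_apply_bcontfun)
    fix F :: "('a \<Rightarrow>\<^sub>C complex) set" assume F: "finite F" "F \<subseteq> metric_algebra"
    have "\<exists>x. \<forall>g\<in>insert f F. norm (apply_bcontfun g x - u g) < min 1 (norm (u f) / 2)"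
      using F \<open>u f \<noteq> 0\<close> vanishing_in_metric_algebra[OF f]
      by (intro points_dense_in_characters[OF A const_in_metric_algebra cnj_in_metric_algebra u])
        auto
    then obtain x where x: "\<And>g. g \<in> insert f F \<Longrightarrow> norm (apply_bcontfun g x - u g) < min 1 (norm (u f) / 2)"
      by blast
    have "norm (u f) \<le> norm (f x) + norm (f x - u f)"
      by (metis norm_minus_commute norm_triangle_sub)
    then have "x \<in> K" using K(2)[of x] x[of f] by force
    then show "K \<inter> (\<Inter>g\<in>F. {x. norm (apply_bcontfun g x - u g) \<le> 1}) \<noteq> {}"
      using x by (force intro: less_imp_le)
  qed
  then obtain x where x: "\<And>g. g \<in> metric_algebra \<Longrightarrow> norm (apply_bcontfun g x - u g) \<le> 1" by blast
  have "u g = g x" if g: "g \<in> metric_algebra" for g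
  proof (rule ccontr)
    assume ne: "u g \<noteq> g x"
    \<comment> \<open>Any factor that makes the difference at \<open>x\<close> exceed the bound \<open>1\<close> would do.\<close>
    define c where "c = 2 / (g x - u g)"
    have "norm (scaleC_bcontfun c g x - u (scaleC_bcontfun c g)) \<le> 1"
      by (rule x[OF norm_closed_subalgebra_scale[OF A g]])
    moreover have "scaleC_bcontfun c g x - u (scaleC_bcontfun c g) = c * (g x - u g)"
      by (simp add: character_on_scale[OF u g] right_diff_distrib)
    moreover have "c * (g x - u g) = 2"
      unfolding c_def using ne by (metis nonzero_divide_eq_eq right_minus_eq)
    ultimately show False by simp
  qed
  moreover have "u \<in> extensional metric_algebra" using u by (simp add: character_on_def)
  ultimately have "u = evaluation_at x"
    unfolding evaluation_at_def by (auto simp: extensional_def)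
  with not_ev show False by blast
qed

text \<open>
  Boundary points agree on constants and on functions vanishing at infinity, and
  \<open>\<phi>\<^sub>x\<^sub>,\<^sub>y = \<phi>\<^sub>x\<^sub>,\<^sub>z - \<phi>\<^sub>y\<^sub>,\<^sub>z\<close>; characters are continuous, so agreement on generators spreads to the
  closed algebra.
\<close>

lemma metric_boundary_eqI:
  assumes u: "u \<in> metric_boundary" and v: "v \<in> metric_boundary"
    and dd: "\<And>y. u (dist_difference y z) = v (dist_difference y z)"
  shows "u = v"
proof -
  note A = norm_closed_subalgebra_metric_algebra
  have cu: "character_on metric_algebra u" and cv: "character_on metric_algebra v"
    using u v by (auto simp: metric_boundary_iff)
  let ?B = "{f \<in> metric_algebra. u f = v f}"
  have "metric_algebra \<subseteq> ?B"
  proof (rule metric_algebra_subset)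
    show "norm_closed_subalgebra ?B"
    proof (rule norm_closed_subalgebraI)
      fix f assume *: "\<And>e. e > 0 \<Longrightarrow> \<exists>g\<in>?B. dist g f < e"
      then have f: "f \<in> metric_algebra"
        by (intro norm_closed_subalgebra_approx[OF A]) blast
      have "dist (u f) (v f) \<le> e" if e: "e > 0" for e
      proof -
        obtain g where g: "g \<in> metric_algebra" "u g = v g" "dist g f < e / 2"
          using *[of "e / 2"] e by auto
        have "dist (w g) (w f) \<le> dist g f" if w: "character_on metric_algebra w" for w
          using character_on_contractive[OF A w norm_closed_subalgebra_diff[OF A g(1) f]]
          by (simp add: dist_norm character_on_diff[OF A w g(1) f])
        from this[OF cu] this[OF cv] g show ?thesis
          using dist_triangle3[of "u f" "v f" "u g"] by simp
      qed
      then have "dist (u f) (v f) \<le> 0" by (rule field_le_epsilon) simp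
      with f show "f \<in> ?B" by simp
    qed (auto simp: norm_closed_subalgebraD[OF A] character_onD[OF cu] character_onD[OF cv]
          character_on_zero[OF A cu] character_on_zero[OF A cv])
    show "vanishing_at_infinity \<subseteq> ?B"
      by (auto simp: metric_boundary_vanishing[OF u] metric_boundary_vanishing[OF v]
          vanishing_in_metric_algebra)
    show "const_bcontfun c \<in> ?B" for c
      by (simp add: const_in_metric_algebra character_on_const[OF cu] character_on_const[OF cv])
    show "dist_difference x y \<in> ?B" for x y
    proof -
      have "dist_difference x y = dist_difference x z - dist_difference y z"
        by (rule bcontfun_eqI) simp
      then show ?thesis
        by (simp add: dd dist_difference_in_metric_algebra norm_closed_subalgebra_diff[OF A]
            character_on_diff[OF A cu] character_on_diff[OF A cv])
    qed
  qed
  then show ?thesis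
    using cu cv by (intro extensionalityI[of u metric_algebra v]) (auto simp: character_on_def)
qed

section \<open>The end of a weakly-geodesic ray\<close>

lemma eventually_at_top_within:
  "eventually P (at_top_within T) \<longleftrightarrow> (\<exists>N. \<forall>t\<in>T. t \<ge> N \<longrightarrow> P t)"
  by (auto simp: at_top_within_def eventually_inf_principal eventually_at_top_linorder)

lemma at_top_within_neq_bot:
  assumes "T \<subseteq> {0..}" "\<not> bounded T"
  shows "at_top_within T \<noteq> bot"
proof
  assume "at_top_within T = bot"
  then have "eventually (\<lambda>_. False) (at_top_within T)" by simp
  then obtain N where "\<forall>t\<in>T. t < N" by (auto simp: eventually_at_top_within not_le)
  then have "T \<subseteq> {0..N}" using assms(1) by force
  with assms(2) show False using bounded_subset bounded_closed_interval by blast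
qed

lemma convergent_iff_cauchy:
  fixes g :: "'b \<Rightarrow> 'c::complete_space"
  assumes "F \<noteq> bot"
  shows "(\<exists>l. (g \<longlongrightarrow> l) F) \<longleftrightarrow>
    (\<forall>e>0. \<exists>P. eventually P F \<and> (\<forall>s t. P s \<and> P t \<longrightarrow> dist (g s) (g t) < e))"
proof -
  have "(\<exists>l. (g \<longlongrightarrow> l) F) \<longleftrightarrow> cauchy_filter (filtermap g F)"
  proof
    assume "\<exists>l. (g \<longlongrightarrow> l) F"
    then show "cauchy_filter (filtermap g F)"
      unfolding filterlim_def by (blast intro: nhds_imp_cauchy_filter)
  next
    assume "cauchy_filter (filtermap g F)"
    from cauchy_filter_complete_converges[OF this complete_UNIV] assms
    show "\<exists>l. (g \<longlongrightarrow> l) F" by (auto simp: filterlim_def filtermap_bot_iff)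
  qed
  then show ?thesis by (simp add: cauchy_filter_metric_filtermap)
qed

text \<open>
  Closedness: the Cauchy criterion passes to uniform limits by the usual three-term estimate.
\<close>

lemma norm_closed_subalgebra_convergent:
  assumes F: "F \<noteq> bot"
  shows "norm_closed_subalgebra
    {f :: 'a::topological_space \<Rightarrow>\<^sub>C complex. \<exists>l. ((\<lambda>t. apply_bcontfun f (\<gamma> t)) \<longlongrightarrow> l) F}"
proof (rule norm_closed_subalgebraI)
  fix f :: "'a \<Rightarrow>\<^sub>C complex"
  assume *: "\<And>e. e > 0 \<Longrightarrow> \<exists>g\<in>{f. \<exists>l. ((\<lambda>t. apply_bcontfun f (\<gamma> t)) \<longlongrightarrow> l) F}. dist g f < e"
  have "\<exists>P. eventually P F \<and> (\<forall>s t. P s \<and> P t \<longrightarrow> dist (f (\<gamma> s)) (f (\<gamma> t)) < e)"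
    if e: "e > 0" for e
  proof -
    obtain g where g: "\<exists>l. ((\<lambda>t. apply_bcontfun g (\<gamma> t)) \<longlongrightarrow> l) F" "dist g f < e / 3"
      using *[of "e / 3"] e by auto
    obtain P where P: "eventually P F"
        "\<And>s t. P s \<and> P t \<Longrightarrow> dist (g (\<gamma> s)) (g (\<gamma> t)) < e / 3"
      using g(1)[unfolded convergent_iff_cauchy[OF F], rule_format, of "e / 3"] e by auto
    have "dist (f (\<gamma> s)) (f (\<gamma> t)) < e" if "P s" "P t" for s t
      using P(2)[of s t] that g(2) dist_bounded[of g "\<gamma> s" f] dist_bounded[of g "\<gamma> t" f]
        dist_triangle3[of "f (\<gamma> s)" "f (\<gamma> t)" "g (\<gamma> s)"]
        dist_triangle[of "g (\<gamma> s)" "f (\<gamma> t)" "g (\<gamma> t)"] by linarith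
    with P(1) show ?thesis by blast
  qed
  then show "f \<in> {f. \<exists>l. ((\<lambda>t. apply_bcontfun f (\<gamma> t)) \<longlongrightarrow> l) F}"
    by (simp add: convergent_iff_cauchy[OF F])
qed (auto intro: tendsto_add tendsto_mult tendsto_mult_left)

lemma weakly_geodesic_ray_convergent:
  fixes \<gamma> :: "real \<Rightarrow> 'a::metric_space"
  assumes \<gamma>: "weakly_geodesic_ray T \<gamma>"
  shows at_top_within_ray_neq_bot: "at_top_within T \<noteq> bot"
    and weakly_geodesic_ray_vanishing:
      "\<And>f. f \<in> vanishing_at_infinity \<Longrightarrow> ((\<lambda>t. apply_bcontfun f (\<gamma> t)) \<longlongrightarrow> 0) (at_top_within T)"
    and weakly_geodesic_ray_has_limits:
      "\<And>f. f \<in> metric_algebra \<Longrightarrow> \<exists>l. ((\<lambda>t. apply_bcontfun f (\<gamma> t)) \<longlongrightarrow> l) (at_top_within T)"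
proof -
  have T: "T \<subseteq> {0..}" "0 \<in> T" "\<not> bounded T"
    and ray: "\<And>y e. e > 0 \<Longrightarrow> \<exists>N::int. \<forall>s\<in>T. \<forall>t\<in>T. s \<ge> of_int N \<and> t \<ge> of_int N \<longrightarrow>
      \<bar>dist (\<gamma> t) (\<gamma> 0) - t\<bar> < e \<and> \<bar>dist (\<gamma> t) y - dist (\<gamma> s) y - (t - s)\<bar> < e"
    using \<gamma> unfolding weakly_geodesic_ray_def by blast+
  show F: "at_top_within T \<noteq> bot" by (rule at_top_within_neq_bot[OF T(1,3)])
  show van: "((\<lambda>t. apply_bcontfun f (\<gamma> t)) \<longlongrightarrow> 0) (at_top_within T)" if f: "f \<in> vanishing_at_infinity" for f
  proof (rule tendstoI)
    fix e :: real assume "e > 0"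
    then obtain K where K: "compact K" "\<And>x. x \<notin> K \<Longrightarrow> norm (f x) < e"
      using f unfolding vanishing_at_infinity_def by blast
    obtain R where R: "\<And>x. x \<in> K \<Longrightarrow> dist (\<gamma> 0) x \<le> R"
      using compact_imp_bounded[OF K(1)] bounded_any_center[of K "\<gamma> 0"] by blast
    obtain N :: int where N: "\<And>t. t \<in> T \<Longrightarrow> t \<ge> of_int N \<Longrightarrow> \<bar>dist (\<gamma> t) (\<gamma> 0) - t\<bar> < 1"
      using ray[of 1 "\<gamma> 0"] by auto
    have "norm (f (\<gamma> t)) < e" if t: "t \<in> T" "t \<ge> max (of_int N) (R + 1)" for t
    proof (rule K(2), rule notI)
      assume "\<gamma> t \<in> K"
      then show False using R[of "\<gamma> t"] N[of t] t by (simp add: dist_commute)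
    qed
    then show "\<forall>\<^sub>F t in at_top_within T. dist (f (\<gamma> t)) 0 < e"
      unfolding eventually_at_top_within by (intro exI[of _ "max (of_int N) (R + 1)"]) auto
  qed
  \<comment> \<open>The limit is the Busemann function of the ray at \<open>y\<close>.\<close>
  have busemann: "\<exists>l. ((\<lambda>t. dist (\<gamma> t) y - t) \<longlongrightarrow> l) (at_top_within T)" for y
    unfolding convergent_iff_cauchy[OF F]
  proof (intro allI impI)
    fix e :: real assume "e > 0"
    then obtain N :: int where N: "\<And>s t. s \<in> T \<Longrightarrow> t \<in> T \<Longrightarrow> s \<ge> of_int N \<Longrightarrow> t \<ge> of_int N \<Longrightarrow>
        \<bar>dist (\<gamma> t) y - dist (\<gamma> s) y - (t - s)\<bar> < e"
      using ray[of e y] by meson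
    have "dist (dist (\<gamma> s) y - s) (dist (\<gamma> t) y - t) < e"
      if "s \<in> T \<and> of_int N \<le> s" "t \<in> T \<and> of_int N \<le> t" for s t
      using N[of t s] that by (simp add: dist_real_def algebra_simps)
    then show "\<exists>P. eventually P (at_top_within T) \<and>
        (\<forall>s t. P s \<and> P t \<longrightarrow> dist (dist (\<gamma> s) y - s) (dist (\<gamma> t) y - t) < e)"
      by (intro exI[of _ "\<lambda>t. t \<in> T \<and> of_int N \<le> t"]) (auto simp: eventually_at_top_within)
  qed
  have "metric_algebra \<subseteq> {f. \<exists>l. ((\<lambda>t. apply_bcontfun f (\<gamma> t)) \<longlongrightarrow> l) (at_top_within T)}"
  proof (rule metric_algebra_subset[OF norm_closed_subalgebra_convergent[OF F]])
    \<comment> \<open>The parameter \<open>t\<close> cancels in \<open>\<rho>(\<gamma>(t),y) - \<rho>(\<gamma>(t),z)\<close>.\<close>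
    fix y z
    obtain k l where "((\<lambda>t. dist (\<gamma> t) y - t) \<longlongrightarrow> k) (at_top_within T)"
      "((\<lambda>t. dist (\<gamma> t) z - t) \<longlongrightarrow> l) (at_top_within T)" using busemann by blast
    from tendsto_of_real[OF tendsto_diff[OF this]]
    have "((\<lambda>t. dist_difference y z (\<gamma> t)) \<longlongrightarrow> of_real (k - l)) (at_top_within T)" by simp
    then show "dist_difference y z \<in> {f. \<exists>l. ((\<lambda>t. apply_bcontfun f (\<gamma> t)) \<longlongrightarrow> l) (at_top_within T)}" by blast
  qed (use van in auto)
  then show "\<exists>l. ((\<lambda>t. apply_bcontfun f (\<gamma> t)) \<longlongrightarrow> l) (at_top_within T)" if "f \<in> metric_algebra" for f
    using that by blast
qed

text \<open>
  The pointwise limits form a character.  It differs from the evaluation at \<open>x\<close> on a tent function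
  supported in a compact ball around \<open>x\<close>, which is positive at \<open>x\<close> but tends to \<open>0\<close> along the ray.
\<close>

lemma weakly_geodesic_ray_boundary_point:
  fixes \<gamma> :: "real \<Rightarrow> 'a::metric_space"
  assumes lc: "locally_compact_space (euclidean :: 'a topology)"
    and \<gamma>: "weakly_geodesic_ray T \<gamma>"
  shows "\<exists>u\<in>metric_boundary. \<forall>f\<in>metric_algebra. ((\<lambda>t. apply_bcontfun f (\<gamma> t)) \<longlongrightarrow> u f) (at_top_within T)"
proof -
  note A = norm_closed_subalgebra_metric_algebra
  let ?F = "at_top_within T"
  note F = at_top_within_ray_neq_bot[OF \<gamma>]
  define u where "u = (\<lambda>f\<in>metric_algebra. Lim ?F (\<lambda>t. apply_bcontfun f (\<gamma> t)))"
  have lim: "((\<lambda>t. apply_bcontfun f (\<gamma> t)) \<longlongrightarrow> u f) ?F" if "f \<in> metric_algebra" for f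
    using weakly_geodesic_ray_has_limits[OF \<gamma> that] that tendsto_Lim[OF F] by (force simp: u_def)
  have uI: "u f = l" if "f \<in> metric_algebra" "((\<lambda>t. apply_bcontfun f (\<gamma> t)) \<longlongrightarrow> l) ?F" for f l
    using tendsto_unique[OF F lim that(2)] that(1) by blast
  have "character_on metric_algebra u"
    unfolding character_on_def
  proof (intro conjI ballI allI)
    show "u \<in> extensional metric_algebra" by (simp add: u_def)
    show "u (f + g) = u f + u g" if "f \<in> metric_algebra" "g \<in> metric_algebra" for f g
      using that by (intro uI norm_closed_subalgebra_add[OF A]) (auto intro!: tendsto_add lim)
    show "u (times_bcontfun f g) = u f * u g" if "f \<in> metric_algebra" "g \<in> metric_algebra" for f g
      using that by (intro uI norm_closed_subalgebra_times[OF A]) (auto intro!: tendsto_mult lim)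
    show "u (scaleC_bcontfun c f) = c * u f" if "f \<in> metric_algebra" for c f
      using that by (intro uI norm_closed_subalgebra_scale[OF A]) (auto intro!: tendsto_mult lim)
    have "u (const_bcontfun 1) = 1" by (intro uI const_in_metric_algebra) simp
    then show "\<exists>f\<in>metric_algebra. u f \<noteq> 0"
      using const_in_metric_algebra[of 1] by (metis zero_neq_one)
  qed
  moreover have "u \<noteq> evaluation_at x" for x
  proof -
    obtain U K where UK: "open U" "compact K" "x \<in> U" "U \<subseteq> K"
      using lc unfolding locally_compact_space_def by (auto dest!: spec[of _ x])
    obtain r where r: "r > 0" "cball x r \<subseteq> U" using UK open_contains_cball by blast
    have "compact (cball x r)"
      using compact_Int_closed[OF UK(2) closed_cball, of x r] r UK by (simp add: Int_absorb1)
    then have v: "tent x r \<in> vanishing_at_infinity" by (rule tent_vanishing_at_infinity)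
    then have t: "tent x r \<in> metric_algebra" by (rule vanishing_in_metric_algebra)
    have "u (tent x r) = 0" by (rule uI[OF t weakly_geodesic_ray_vanishing[OF \<gamma> v]])
    moreover have "evaluation_at x (tent x r) \<noteq> 0" using t r by (simp add: evaluation_at_def)
    ultimately show ?thesis by auto
  qed
  ultimately have "u \<in> metric_boundary" by (simp add: metric_boundary_iff)
  with lim show ?thesis by blast
qed

section \<open>A ray to every boundary point\<close>

text \<open>
  The point \<open>x\<^sub>n\<close> is chosen near \<open>u\<close> with respect to the functions \<open>\<phi>\<^sub>d\<^sub>,\<^sub>z\<close> for the first \<open>n + 1\<close>
  members \<open>d\<close> of a countable dense set and to one tent function, which is at least \<open>1\<close> on the ball
  of radius \<open>n\<close> but killed by \<open>u\<close>; this keeps \<open>x\<^sub>n\<close> off that ball.  Convergence for all \<open>y\<close>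
  follows because \<open>\<parallel>\<phi>\<^sub>y\<^sub>,\<^sub>z - \<phi>\<^sub>d\<^sub>,\<^sub>z\<parallel> \<le> \<rho>(d,y)\<close> and \<open>u\<close> is contractive.
\<close>

lemma metric_boundary_sequence:
  fixes u :: "('a::metric_space \<Rightarrow>\<^sub>C complex) \<Rightarrow> complex"
  assumes u: "u \<in> metric_boundary" and proper: "proper_metric TYPE('a)"
    and sc: "second_countable (euclidean :: 'a topology)"
  obtains x :: "nat \<Rightarrow> 'a" where "\<And>n. dist (x n) z > real n"
    "\<And>y. (\<lambda>n. dist_difference y z (x n)) \<longlonglongrightarrow> u (dist_difference y z)"
proof -
  note A = norm_closed_subalgebra_metric_algebra
  have cu: "character_on metric_algebra u" using u by (simp add: metric_boundary_iff)
  obtain D :: "'a set" where D: "countable D" "closure D = UNIV"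
    using second_countable_imp_separable_space[OF sc] unfolding separable_space_def by auto
  have "D \<noteq> {}" using D(2) by auto
  define d where "d = from_nat_into D"
  have range_d: "range d = D" unfolding d_def by (rule range_from_nat_into[OF \<open>D \<noteq> {}\<close> D(1)])
  have tent: "tent z r \<in> vanishing_at_infinity" for r
    using proper by (intro tent_vanishing_at_infinity) (auto simp: proper_metric_def)
  have "\<exists>p. \<forall>f\<in>insert (tent z (real n + 1)) ((\<lambda>i. dist_difference (d i) z) ` {..n}).
      norm (apply_bcontfun f p - u f) < 1 / (real n + 1)" for n
    by (intro points_dense_in_characters[OF A const_in_metric_algebra cnj_in_metric_algebra cu])
      (use tent in \<open>auto simp: dist_difference_in_metric_algebra vanishing_in_metric_algebra\<close>)
  then obtain x where x: "\<And>n f. f \<in> insert (tent z (real n + 1))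
      ((\<lambda>i. dist_difference (d i) z) ` {..n}) \<Longrightarrow> norm (apply_bcontfun f (x n) - u f) < 1 / (real n + 1)"
    by metis
  show thesis
  proof (rule that[of x])
    fix n
    have "u (tent z (real n + 1)) = 0" by (rule metric_boundary_vanishing[OF u tent])
    then have "norm (tent z (real n + 1) (x n)) < 1 / (real n + 1)"
      using x[of "tent z (real n + 1)" n] by simp
    also have "\<dots> \<le> 1" by simp
    finally show "dist (x n) z > real n" unfolding apply_tent norm_of_real by simp
  next
    fix y
    show "(\<lambda>n. dist_difference y z (x n)) \<longlonglongrightarrow> u (dist_difference y z)"
    proof (rule LIMSEQ_I)
      fix e :: real assume e: "e > 0"
      have "y \<in> closure D" using D by simp
      then obtain i where i: "dist (d i) y < e / 3"
        using e range_d unfolding closure_approachable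
        by (metis divide_pos_pos imageE zero_less_numeral)
      let ?f = "dist_difference y z" and ?g = "dist_difference (d i) z"
      have fg: "norm (?f - ?g) \<le> dist (d i) y"
      proof (rule norm_bound)
        fix p
        have "(?f - ?g) p = of_real (dist p y - dist p (d i))" by simp
        then have "norm ((?f - ?g) p) = \<bar>dist p y - dist p (d i)\<bar>" by (simp only: norm_of_real)
        also have "\<dots> \<le> dist (d i) y"
          using dist_triangle[of p y "d i"] dist_triangle2[of p "d i" y] by (simp add: abs_le_iff dist_commute)
        finally show "norm ((?f - ?g) p) \<le> dist (d i) y" .
      qed
      have ufg: "norm (u ?f - u ?g) \<le> dist (d i) y"
        using character_on_contractive[OF A cu norm_closed_subalgebra_diff[OF A], of ?f ?g] fg
        by (simp add: character_on_diff[OF A cu] dist_difference_in_metric_algebra)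
      obtain m :: nat where m: "inverse (real (Suc m)) < e / 3" using reals_Archimedean e
        by (metis divide_pos_pos zero_less_numeral)
      have "norm (?f (x n) - u ?f) < e" if n: "n \<ge> max i m" for n
      proof -
        have "norm (?g (x n) - u ?g) < 1 / (real n + 1)" using n by (intro x) auto
        also have "\<dots> \<le> inverse (real (Suc m))" using n by (simp add: inverse_eq_divide frac_le)
        finally have "norm (?g (x n) - u ?g) < e / 3" using m by simp
        moreover have "norm (?f (x n) - ?g (x n)) \<le> dist (d i) y"
          using norm_bounded[of "?f - ?g" "x n"] fg by simp
        moreover have "norm (?f (x n) - u ?f)
            \<le> norm (?f (x n) - ?g (x n)) + norm (?g (x n) - u ?g) + norm (u ?f - u ?g)"
          using dist_triangle[of "?f (x n)" "u ?f" "?g (x n)"]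
            dist_triangle[of "?g (x n)" "u ?f" "u ?g"]
          unfolding dist_norm norm_minus_commute[of "u ?g"] by linarith
        ultimately show ?thesis
          using i ufg by linarith
      qed
      then show "\<exists>no. \<forall>n\<ge>no. norm (?f (x n) - u ?f) < e" by blast
    qed
  qed
qed

text \<open>
  If time is exactly the distance from the origin of the ray, then
  \<open>\<rho>(\<gamma>(t),y) - t = \<phi>\<^sub>y\<^sub>,\<^sub>\<gamma>\<^sub>(\<^sub>0\<^sub>)(\<gamma>(t))\<close>, so the second condition on a weakly-geodesic ray is the
  Cauchy criterion for this function.
\<close>

lemma weakly_geodesic_rayI:
  fixes \<gamma> :: "real \<Rightarrow> 'a::metric_space"
  assumes T: "T \<subseteq> {0..}" "0 \<in> T" "\<not> bounded T"
    and dist: "\<And>t. t \<in> T \<Longrightarrow> dist (\<gamma> t) (\<gamma> 0) = t"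
    and lim: "\<And>y. \<exists>l. ((\<lambda>t. dist_difference y (\<gamma> 0) (\<gamma> t)) \<longlongrightarrow> l) (at_top_within T)"
  shows "weakly_geodesic_ray T \<gamma>"
  unfolding weakly_geodesic_ray_def
proof (intro conjI T allI impI)
  fix y and e :: real assume e: "e > 0"
  obtain P where P: "eventually P (at_top_within T)" "\<And>s t. P s \<Longrightarrow> P t \<Longrightarrow>
      dist (dist_difference y (\<gamma> 0) (\<gamma> s)) (dist_difference y (\<gamma> 0) (\<gamma> t)) < e"
    using lim[of y] e unfolding convergent_iff_cauchy[OF at_top_within_neq_bot[OF T(1,3)]] by meson
  obtain N where N: "\<And>t. t \<in> T \<Longrightarrow> t \<ge> N \<Longrightarrow> P t"
    using P(1) by (auto simp: eventually_at_top_within)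
  have "\<bar>dist (\<gamma> t) y - dist (\<gamma> s) y - (t - s)\<bar> < e"
    if st: "s \<in> T" "t \<in> T" "s \<ge> of_int \<lceil>N\<rceil>" "t \<ge> of_int \<lceil>N\<rceil>" for s t
  proof -
    have "P s" "P t" using st N by (auto simp: ceiling_le_iff intro: order_trans[OF le_of_int_ceiling])
    from P(2)[OF this] show ?thesis
      using dist[OF st(1)] dist[OF st(2)]
      by (simp add: dist_norm algebra_simps flip: of_real_diff of_real_add)
  qed
  then show "\<exists>N::int. \<forall>s\<in>T. \<forall>t\<in>T. s \<ge> of_int N \<and> t \<ge> of_int N \<longrightarrow>
      \<bar>dist (\<gamma> t) (\<gamma> 0) - t\<bar> < e \<and> \<bar>dist (\<gamma> t) y - dist (\<gamma> s) y - (t - s)\<bar> < e"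
    using e dist by (intro exI[of _ "\<lceil>N\<rceil>"]) auto
qed

text \<open>
  The ray visits a point of the sequence at the time given by its distance from \<open>z\<close>.  Several
  points may share a distance, and the distances need not increase with \<open>n\<close>; it is enough to choose
  one index for each distance.  A time beyond \<open>\<rho>(x\<^sub>0,z), \<dots>, \<rho>(x\<^sub>n\<^sub>-\<^sub>1,z)\<close> can only have an index
  \<open>\<ge> n\<close>, so the index tends to infinity with the time.
\<close>

lemma weakly_geodesic_ray_of_sequence:
  fixes x :: "nat \<Rightarrow> 'a::metric_space"
  assumes far: "\<And>n. dist (x n) z > real n"
    and lim: "\<And>y. (\<lambda>n. dist_difference y z (x n)) \<longlonglongrightarrow> h y"
  obtains T \<gamma> where "weakly_geodesic_ray T \<gamma>"
    "\<And>y. ((\<lambda>t. dist_difference y z (\<gamma> t)) \<longlongrightarrow> h y) (at_top_within T)"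
proof -
  define r where "r n = dist (x n) z" for n
  define T where "T = insert 0 (range r)"
  define index where "index t = (SOME n. r n = t)" for t
  define \<gamma> where "\<gamma> t = (if t = 0 then z else x (index t))" for t
  have pos: "r n > 0" for n using far[of n] unfolding r_def by (rule le_less_trans[rotated]) simp
  have index: "r (index t) = t" if "t \<in> T" "t \<noteq> 0" for t
  proof -
    have "\<exists>n. r n = t" using that by (auto simp: T_def)
    then show ?thesis unfolding index_def by (rule someI_ex)
  qed
  have T: "T \<subseteq> {0..}" "0 \<in> T" using pos by (auto simp: T_def less_imp_le)
  have unb: "\<not> bounded T"
  proof
    assume "bounded T"
    then obtain B where B: "\<And>t. t \<in> T \<Longrightarrow> \<bar>t\<bar> \<le> B" by (auto simp: bounded_iff)
    obtain n where "B < real n" using reals_Archimedean2 by blast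
    then show False using far[of n] B[of "r n"] pos[of n] by (auto simp: T_def r_def)
  qed
  have dist: "dist (\<gamma> t) (\<gamma> 0) = t" if "t \<in> T" for t
    using index[OF that] by (simp add: \<gamma>_def r_def)
  have "\<forall>\<^sub>F t in at_top_within T. n \<le> index t" for n
    unfolding eventually_at_top_within
    \<comment> \<open>The sum is a convenient bound for all of \<open>r 0, \<dots>, r (n - 1)\<close>, also when \<open>n = 0\<close>.\<close>
  proof (intro exI[of _ "(\<Sum>i<n. r i) + 1"] ballI impI)
    fix t assume t: "t \<in> T" "(\<Sum>i<n. r i) + 1 \<le> t"
    have "t \<noteq> 0" using t(2) sum_nonneg[of "{..<n}" r] pos by (smt (verit))
    show "n \<le> index t"
    proof (rule ccontr)
      assume "\<not> n \<le> index t"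
      then have "r (index t) \<le> (\<Sum>i<n. r i)"
        using pos by (intro member_le_sum) (auto simp: less_imp_le)
      with t index[OF t(1) \<open>t \<noteq> 0\<close>] show False by simp
    qed
  qed
  then have "filterlim index sequentially (at_top_within T)" by (simp add: filterlim_at_top)
  then have "((\<lambda>t. dist_difference y z (x (index t))) \<longlongrightarrow> h y) (at_top_within T)" for y
    by (rule filterlim_compose[OF lim])
  moreover have "\<forall>\<^sub>F t in at_top_within T.
      dist_difference y z (x (index t)) = dist_difference y z (\<gamma> t)" for y
    unfolding eventually_at_top_within by (intro exI[of _ 1]) (auto simp: \<gamma>_def)
  ultimately have lim': "((\<lambda>t. dist_difference y z (\<gamma> t)) \<longlongrightarrow> h y) (at_top_within T)" for y
    by (rule Lim_transform_eventually)
  have "weakly_geodesic_ray T \<gamma>"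
    by (rule weakly_geodesic_rayI[OF T unb dist]) (use lim' in \<open>auto simp: \<gamma>_def\<close>)
  from that[OF this lim'] show thesis .
qed

theorem theorem4p7:
  assumes "locally_compact_space (euclidean :: 'a::complete_space topology)"
  shows "(\<forall>T (\<gamma> :: real \<Rightarrow> 'a). weakly_geodesic_ray T \<gamma> \<longrightarrow>
      (\<forall>f\<in>metric_algebra. \<exists>l. ((\<lambda>t. apply_bcontfun f (\<gamma> t)) \<longlongrightarrow> l) (at_top_within T)) \<and>
      (\<exists>u\<in>metric_boundary. \<forall>f\<in>metric_algebra. ((\<lambda>t. apply_bcontfun f (\<gamma> t)) \<longlongrightarrow> u f) (at_top_within T))) \<and>
    (proper_metric TYPE('a) \<and> second_countable (euclidean :: 'a topology) \<longrightarrow>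
      (\<forall>u\<in>metric_boundary. \<exists>T (\<gamma> :: real \<Rightarrow> 'a). weakly_geodesic_ray T \<gamma> \<and>
        (\<forall>f\<in>metric_algebra. ((\<lambda>t. apply_bcontfun f (\<gamma> t)) \<longlongrightarrow> u f) (at_top_within T))))"
proof (intro conjI allI impI ballI)
  fix T and \<gamma> :: "real \<Rightarrow> 'a" assume \<gamma>: "weakly_geodesic_ray T \<gamma>"
  show "\<exists>l. ((\<lambda>t. apply_bcontfun f (\<gamma> t)) \<longlongrightarrow> l) (at_top_within T)" if "f \<in> metric_algebra" for f
    by (rule weakly_geodesic_ray_has_limits[OF \<gamma> that])
  show "\<exists>u\<in>metric_boundary. \<forall>f\<in>metric_algebra.
      ((\<lambda>t. apply_bcontfun f (\<gamma> t)) \<longlongrightarrow> u f) (at_top_within T)"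
    by (rule weakly_geodesic_ray_boundary_point[OF assms \<gamma>])
next
  fix u :: "('a \<Rightarrow>\<^sub>C complex) \<Rightarrow> complex"
  assume "proper_metric TYPE('a) \<and> second_countable (euclidean :: 'a topology)"
    and u: "u \<in> metric_boundary"
  then have proper: "proper_metric TYPE('a)" and sc: "second_countable (euclidean :: 'a topology)"
    by auto
  fix z :: 'a
  obtain x where x: "\<And>n. dist (x n) z > real n"
    "\<And>y. (\<lambda>n. dist_difference y z (x n)) \<longlonglongrightarrow> u (dist_difference y z)"
    using metric_boundary_sequence[OF u proper sc, of z] by blast
  obtain T \<gamma> where \<gamma>: "weakly_geodesic_ray T \<gamma>"
    and lim: "\<And>y. ((\<lambda>t. dist_difference y z (\<gamma> t)) \<longlongrightarrow> u (dist_difference y z)) (at_top_within T)"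
    using weakly_geodesic_ray_of_sequence[OF x] by blast
  obtain v where v: "v \<in> metric_boundary"
    "\<And>f. f \<in> metric_algebra \<Longrightarrow> ((\<lambda>t. apply_bcontfun f (\<gamma> t)) \<longlongrightarrow> v f) (at_top_within T)"
    using weakly_geodesic_ray_boundary_point[OF assms \<gamma>] by blast
  have "u (dist_difference y z) = v (dist_difference y z)" for y
    by (rule tendsto_unique[OF at_top_within_ray_neq_bot[OF \<gamma>] lim
          v(2)[OF dist_difference_in_metric_algebra]])
  then have "u = v" by (rule metric_boundary_eqI[OF u v(1)])
  with \<gamma> v(2) show "\<exists>T \<gamma>. weakly_geodesic_ray T \<gamma> \<and>
      (\<forall>f\<in>metric_algebra. ((\<lambda>t. apply_bcontfun f (\<gamma> t)) \<longlongrightarrow> u f) (at_top_within T))"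
    by blast
qed

end
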